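(* Let $G$ be either the De Bruijn digraph $B(d,D)$ or the Kautz digraph $K(d,D)$, with vertex set $V$, and assume $d\ge 3$. Let $v=v_1\cdots v_D\in V$, $w=w_1\cdots w_D\in S_1(v)$, and let $1\le i\le D$. Then: (1) If $i=j=D$, then $S_{i}^\star(v) \cap S_{j}^{\star}(w)\ne\emptyset$. (2) If $D\ge j\ge i\ne D$, then $S_{i}^\star(v) \cap S_{j}^{\star}(w)\ne\emptyset$ if and only if $S_i(v)\cap S_j(w)\neq \emptyset$ and $S_i(v)\not\subseteq S_{k,j}(w)$ for all $k$ with $i \le k < j$. (3) The intersection $S_{i}^\star(v) \cap S_{i-1}^{\star}(w)$ is empty if and only if $G=B(d,D)$ and $v_i=v_{i+1}=\cdots=v_D=w_D$. Furthermore, if $S_{i}^\star(v)\cap S_{i-1}^{\star}(w)=\emptyset$, then $S_{i}^\star(v)\cap S_{i}^{\star}(w)\ne\emptyset$. (4) There exists a unique integer $j$, $i\le j\le D$, such that the intersection $S_{i}^\star(v) \cap S_{j}^{\star}(w)$ is nonempty.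
   Context: Let $d\ge 2$ and $D\ge 1$ be integers. The De Bruijn digraph $B(d,D)$ has as vertices all words $v=v_1v_2\cdots v_D$ over an alphabet $A$ with $|A|=d$; $v$ is adjacent to the $d$ vertices $v_2\cdots v_D v_{D+1}$, $v_{D+1}\in A$ (loops occur). The Kautz digraph $K(d,D)$ has as vertices all words $v=v_1v_2\cdots v_D$ over an alphabet $A$ with $|A|=d+1$ such that $v_k\ne v_{k+1}$ for $1\le k<D$; $v$ is adjacent to the $d$ vertices $v_2\cdots v_Dv_{D+1}$ with $v_{D+1}\in A$, $v_{D+1}\ne v_D$. Both are $d$-regular of diameter $D$. For $v\in V$ and $i\ge 0$, $S_i(v)$ is the set of vertices $u$ for which there is a walk of length exactly $i$ from $v$ to $u$ (so $S_1(v)$ is the set of vertices adjacent from $v$), and $S_i^\star(v)$ is the set of vertices at (directed) distance exactly $i$ from $v$. For integers $0\le k\le i\le D$: $S_{k,i}(v)=S_k(v)$ if $S_k(v)\subseteq S_i(v)$ and, for all $j$ with $k<j<i$ such that $S_j(v)\subseteq S_i(v)$, we have $S_k(v)\not\subseteq S_j(v)$; otherwise $S_{k,i}(v)=\emptyset$. *)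

theory Defs
  imports "Graph_Theory.Pair_Digraph" "Graph_Theory.Shortest_Path"
begin

text \<open>
  The vertex word v_1 ... v_D is a list of length D, so its letter v_k is \<open>v ! (k - 1)\<close>.
  The size of the alphabet (d for De Bruijn, d + 1 for Kautz) is left to the user of the definitions.
\<close>

definition de_bruijn :: "'a set \<Rightarrow> nat \<Rightarrow> 'a list pair_pre_digraph" where
  "de_bruijn A D =
    (let V = {u \<in> lists A. length u = D}
     in \<lparr> pverts = V, parcs = {(u, tl u @ [a]) | u a. u \<in> V \<and> a \<in> A} \<rparr>)"

definition kautz :: "'a set \<Rightarrow> nat \<Rightarrow> 'a list pair_pre_digraph" where
  "kautz A D =
    (let V = {u \<in> lists A. length u = D \<and> distinct_adj u}
     in \<lparr> pverts = V, parcs = {(u, tl u @ [a]) | u a. u \<in> V \<and> a \<in> A \<and> a \<noteq> last u} \<rparr>)"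

definition walk_sphere :: "'v pair_pre_digraph \<Rightarrow> nat \<Rightarrow> 'v \<Rightarrow> 'v set" where
  "walk_sphere G i v = {u. \<exists>p. pre_digraph.awalk (with_proj G) v p u \<and> length p = i}"

text \<open>Directed distance is the minimum walk cost when every arc has weight 1.\<close>

definition dist_sphere :: "'v pair_pre_digraph \<Rightarrow> nat \<Rightarrow> 'v \<Rightarrow> 'v set" where
  "dist_sphere G i v =
    {u \<in> pverts G. wf_digraph.\<mu> (with_proj G) (\<lambda>_. 1) v u = ereal (real i)}"

text \<open>\<open>walk_sphere_in G k i v\<close> is the set S_{k,i}(v), for k at most i.\<close>

definition walk_sphere_in :: "'v pair_pre_digraph \<Rightarrow> nat \<Rightarrow> nat \<Rightarrow> 'v \<Rightarrow> 'v set" where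
  "walk_sphere_in G k i v =
    (if walk_sphere G k v \<subseteq> walk_sphere G i v \<and>
        (\<forall>j. k < j \<and> j < i \<and> walk_sphere G j v \<subseteq> walk_sphere G i v \<longrightarrow>
             \<not> walk_sphere G k v \<subseteq> walk_sphere G j v)
     then walk_sphere G k v else {})"

text \<open>
  The library defines \<open>wf_digraph.\<mu>\<close> for well-formed digraphs only, which both families are.
\<close>

lemma wf_digraph_de_bruijn:
  assumes "D \<ge> 1"
  shows "wf_digraph (with_proj (de_bruijn A D))"
proof
  fix e assume "e \<in> arcs (with_proj (de_bruijn A D))"
  then obtain u a where ua: "e = (u, tl u @ [a])" "u \<in> lists A" "length u = D" "a \<in> A"
    by (auto simp: de_bruijn_def Let_def)
  then obtain x xs where u: "u = x # xs"
    using assms by (cases u) auto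
  then show "head (with_proj (de_bruijn A D)) e \<in> verts (with_proj (de_bruijn A D))"
    using ua by (auto simp: de_bruijn_def Let_def)
  show "tail (with_proj (de_bruijn A D)) e \<in> verts (with_proj (de_bruijn A D))"
    using ua by (auto simp: de_bruijn_def Let_def)
qed

lemma wf_digraph_kautz:
  assumes "D \<ge> 1"
  shows "wf_digraph (with_proj (kautz A D))"
proof
  fix e assume e: "e \<in> arcs (with_proj (kautz A D))"
  then obtain u a where ua: "e = (u, tl u @ [a])" "u \<in> lists A" "length u = D"
      "distinct_adj u" "a \<in> A" "a \<noteq> last u"
    by (auto simp: kautz_def Let_def)
  then obtain x xs where u: "u = x # xs"
    using assms by (cases u) auto
  then show "head (with_proj (kautz A D)) e \<in> verts (with_proj (kautz A D))"
    using ua by (auto simp: kautz_def Let_def distinct_adj_append_iff distinct_adj_Cons)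
  show "tail (with_proj (kautz A D)) e \<in> verts (with_proj (kautz A D))"
    using ua by (auto simp: kautz_def Let_def)
qed

end

theory Submission
  imports Defs
begin

text \<open>
  A vertex at the end of a walk of length \<open>i\<close> from \<open>v\<close> is obtained by erasing the first \<open>i\<close> letters
  of \<open>v\<close> and appending \<open>i\<close> new ones. So for \<open>i < D\<close> the set \<open>S_i(v)\<close> is a cylinder: it consists of
  all vertices with the prefix \<open>drop i v\<close>, of length \<open>D - i\<close>. Only \<open>i = D\<close> differs: there the prefix is
  empty, and for Kautz digraphs the first letter has to differ from the last letter of \<open>v\<close>. Two facts
  about cylinders give everything.

  They are laminar: for \<open>i \<le> j\<close> and \<open>i < D\<close>, a set \<open>S_i(v)\<close> is either contained in \<open>S_j(w)\<close> or disjoint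
  from it, because membership in \<open>S_j(w)\<close> depends only on the prefix that all of \<open>S_i(v)\<close> shares
  (\<open>S_subset_or_disjoint\<close>).

  They are not covered by smaller ones: for \<open>i < D\<close>, the sets \<open>S_k(v)\<close> and \<open>S_k(w)\<close> with \<open>k < i\<close> never
  fill \<open>S_i(v)\<close> (\<open>sphere_not_covered\<close>). They prescribe two forbidden prefixes for each length
  above \<open>D - i\<close>, and a word that avoids them all can be built letter by letter, since a letter has at
  least three possible successors. This is where \<open>d \<ge> 3\<close> enters.

  The distance sphere \<open>S_i\<^sup>\<star>(v)\<close> is \<open>S_i(v)\<close> minus all \<open>S_k(v)\<close> with \<open>k < i\<close>. Hence, for \<open>i < D\<close> and
  \<open>i \<le> j \<le> D\<close>, the spheres \<open>S_i\<^sup>\<star>(v)\<close> and \<open>S_j\<^sup>\<star>(w)\<close> meet iff \<open>j\<close> is the least index \<open>\<ge> i\<close> with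
  \<open>S_i(v) \<subseteq> S_j(w)\<close> (\<open>S_dist_meet_iff_least\<close>). This yields the uniqueness of \<open>j\<close> and, by laminarity,
  the criterion in terms of the sets \<open>S_{k,j}(w)\<close>. For \<open>i = j = D\<close> the same letter-by-letter
  construction works from the empty prefix: a first letter different from the last letters of \<open>v\<close>
  and \<open>w\<close> is allowed after both (\<open>S_dist_D_meet\<close>).

  For an arc from \<open>v\<close> to \<open>w\<close> the set \<open>S_{i-1}(w)\<close> lies in \<open>S_i(v)\<close>, so a vertex of \<open>S_{i-1}\<^sup>\<star>(w)\<close>
  outside \<open>S_i\<^sup>\<star>(v)\<close> is in some smaller \<open>S_k(v)\<close>. By the avoidance argument this holds for all of them
  only if \<open>S_{i-1}(v) = S_{i-1}(w)\<close> (\<open>S_dist_pred_disjoint_iff\<close>). The two prefixes are then equal, and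
  since one is the other shifted by a letter, all letters involved coincide. In a Kautz digraph this
  is impossible, and in a De Bruijn digraph it makes \<open>S_i(v)\<close> and \<open>S_i(w)\<close> equal as well.
\<close>

section \<open>Spheres in a digraph\<close>

text \<open>With unit weights the infimum runs over natural numbers and is attained by a shortest walk.\<close>

lemma (in wf_digraph) mu_unit_eq_iff:
  "\<mu> (\<lambda>_. 1) u v = ereal (real n) \<longleftrightarrow>
     (\<exists>p. awalk u p v \<and> length p = n) \<and> (\<forall>p. awalk u p v \<longrightarrow> n \<le> length p)"
proof -
  have cost: "awalk_cost (\<lambda>_. 1) p = real (length p)" for p
    by (simp add: awalk_cost_def sum_list_triv)
  show ?thesis
  proof (cases "\<exists>p. awalk u p v")
    case False
    then show ?thesis by (simp add: \<mu>_def top_ereal_def)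
  next
    case True
    define m where "m = (LEAST m. \<exists>p. awalk u p v \<and> length p = m)"
    have m_attained: "\<exists>p. awalk u p v \<and> length p = m"
      unfolding m_def by (rule LeastI_ex) (use True in blast)
    have m_least: "m \<le> length p" if "awalk u p v" for p
      unfolding m_def using that by (blast intro: Least_le)
    have "\<mu> (\<lambda>_. 1) u v = ereal (real m)"
      unfolding \<mu>_def
    proof (rule antisym)
      from m_attained obtain p where "awalk u p v" "length p = m" by blast
      then show "(INF p\<in>{p. awalk u p v}. ereal (awalk_cost (\<lambda>_. 1) p)) \<le> ereal (real m)"
        by (intro INF_lower2[of p]) (auto simp: cost)
    qed (auto simp: cost m_least intro!: INF_greatest)
    then have "\<mu> (\<lambda>_. 1) u v = ereal (real n) \<longleftrightarrow> n = m" by auto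
    also have "\<dots> \<longleftrightarrow> (\<exists>p. awalk u p v \<and> length p = n) \<and> (\<forall>p. awalk u p v \<longrightarrow> n \<le> length p)"
      using m_attained m_least by (metis antisym)
    finally show ?thesis .
  qed
qed

lemma dist_sphere_eq:
  assumes "wf_digraph (with_proj G)"
  shows "dist_sphere G i v = {u \<in> walk_sphere G i v. \<forall>k<i. u \<notin> walk_sphere G k v}"
proof -
  interpret wf_digraph "with_proj G" by (fact assms)
  have "u \<in> pverts G" if "awalk v p u" for p u
    using awalk_last_in_verts[OF that] by simp
  then show ?thesis
    unfolding dist_sphere_def walk_sphere_def mu_unit_eq_iff
    by (auto dest: leD intro: leI)
qed

lemma walk_sphere_0:
  assumes "wf_digraph (with_proj G)" "v \<in> pverts G"
  shows "walk_sphere G 0 v = {v}"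
proof -
  interpret wf_digraph "with_proj G" by (fact assms(1))
  show ?thesis using assms(2) by (auto simp: walk_sphere_def awalk_Nil_iff)
qed

lemma walk_sphere_Suc:
  assumes "wf_digraph (with_proj G)"
  shows "walk_sphere G (Suc i) v = (\<Union>t\<in>{t. (v, t) \<in> parcs G}. walk_sphere G i t)"
proof -
  interpret wf_digraph "with_proj G" by (fact assms)
  have "(\<exists>p. awalk v p u \<and> length p = Suc i) \<longleftrightarrow>
      (\<exists>t p. (v, t) \<in> parcs G \<and> awalk t p u \<and> length p = i)" for u
  proof
    assume "\<exists>p. awalk v p u \<and> length p = Suc i"
    then show "\<exists>t p. (v, t) \<in> parcs G \<and> awalk t p u \<and> length p = i"
      by (fastforce simp: length_Suc_conv awalk_Cons_iff)
  next
    assume "\<exists>t p. (v, t) \<in> parcs G \<and> awalk t p u \<and> length p = i"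
    then obtain t p where "(v, t) \<in> parcs G" "awalk t p u" "length p = i" by blast
    then show "\<exists>p. awalk v p u \<and> length p = Suc i"
      by (intro exI[of _ "(v, t) # p"]) (simp add: awalk_Cons_iff)
  qed
  then show ?thesis
    by (auto simp: walk_sphere_def)
qed

section \<open>Digraphs of words with restricted consecutive letters\<close>

text \<open>
  De Bruijn digraphs allow every letter after every letter and Kautz digraphs every different one.
  The relation \<open>R\<close> of allowed consecutive letters covers both at once.
\<close>

definition word_digraph :: "'a set \<Rightarrow> ('a \<Rightarrow> 'a \<Rightarrow> bool) \<Rightarrow> nat \<Rightarrow> 'a list pair_pre_digraph" where
  "word_digraph A R D =
    (let V = {u \<in> lists A. length u = D \<and> successively R u}
     in \<lparr> pverts = V, parcs = {(u, tl u @ [a]) | u a. u \<in> V \<and> a \<in> A \<and> R (last u) a} \<rparr>)"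

lemma de_bruijn_eq_word_digraph: "de_bruijn A D = word_digraph A (\<lambda>_ _. True) D"
proof -
  have "successively (\<lambda>_ _. True) u" for u :: "'a list"
    by (induction u) (auto simp: successively_Cons)
  then show ?thesis by (simp add: de_bruijn_def word_digraph_def)
qed

lemma kautz_eq_word_digraph: "kautz A D = word_digraph A (\<noteq>) D"
  by (simp add: kautz_def word_digraph_def distinct_adj_def eq_commute[of "last _"])

text \<open>
  The three successors are needed to continue a word while avoiding two letters. That distinct
  letters are always compatible matters at distance \<open>D\<close>, where the first letter of the new word only
  has to be allowed after the last letter of the old one.
\<close>

locale word_shift =
  fixes A :: "'a set" and R :: "'a \<Rightarrow> 'a \<Rightarrow> bool" and D :: nat
  assumes D_pos: "D \<ge> 1"
    and neq_imp_R: "a \<noteq> b \<Longrightarrow> R a b"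
    and three_successors: "card {b \<in> A. R a b} \<ge> 3"
begin

abbreviation "G \<equiv> word_digraph A R D"
abbreviation "V \<equiv> pverts G"
abbreviation "S \<equiv> walk_sphere G"
abbreviation "S_dist \<equiv> dist_sphere G"

lemma V_iff: "u \<in> V \<longleftrightarrow> u \<in> lists A \<and> length u = D \<and> successively R u"
  by (simp add: word_digraph_def)

lemma arc_iff: "(u, t) \<in> parcs G \<longleftrightarrow> u \<in> V \<and> (\<exists>a\<in>A. R (last u) a \<and> t = tl u @ [a])"
  by (auto simp: word_digraph_def)

lemma V_not_Nil: "u \<in> V \<Longrightarrow> u \<noteq> []"
  using D_pos by (auto simp: V_iff)

lemma successor_in_V:
  assumes "u \<in> V" "a \<in> A" "R (last u) a"
  shows "tl u @ [a] \<in> V"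
proof (cases u)
  case (Cons c t)
  then show ?thesis
    using assms by (auto simp: V_iff successively_append_iff successively_Cons split: if_splits)
qed (use assms V_not_Nil in auto)

lemma wf: "wf_digraph (with_proj G)"
  by standard (auto simp: arc_iff successor_in_V)

section \<open>Walk spheres are cylinders\<close>

text \<open>
  The last letter of \<open>v\<close> is erased only by the \<open>D\<close>-th step. Until then compatibility of the first
  appended letter with \<open>last v\<close> is a condition inside the word \<open>u\<close>; afterwards it has to be
  demanded separately.
\<close>

lemma S_eq_cylinder:
  assumes "v \<in> V" "i \<le> D"
  shows "S i v = {u \<in> V. take (D - i) u = drop i v \<and> (i = D \<longrightarrow> R (last v) (hd u))}"
  using assms
proof (induction i arbitrary: v)
  case 0
  then show ?case using D_pos by (auto simp: walk_sphere_0[OF wf] V_iff)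
next
  case (Suc i)
  have len: "length v = D" and ne: "v \<noteq> []"
    using Suc.prems V_not_Nil by (auto simp: V_iff)
  have IH: "S i (tl v @ [a]) = {u \<in> V. take (D - i) u = drop (Suc i) v @ [a]}"
    if "a \<in> A" "R (last v) a" for a
    using Suc.IH[OF successor_in_V[OF Suc.prems(1) that]] Suc.prems(2) len
    by (auto simp: drop_Suc)
  have split: "take (D - i) u = take (D - Suc i) u @ [u ! (D - Suc i)]" if "u \<in> V" for u
    using that Suc.prems(2) take_Suc_conv_app_nth[of "D - Suc i" u]
    by (simp add: V_iff Suc_diff_Suc)
  have link: "R (last v) (u ! (D - Suc i)) \<longleftrightarrow> (Suc i = D \<longrightarrow> R (last v) (hd u))"
    if u: "u \<in> V" and pre: "take (D - Suc i) u = drop (Suc i) v" for u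
    \<comment> \<open>The letter \<open>u ! (D - Suc i)\<close> is the one appended by the first step of the walk.\<close>
  proof (cases "Suc i = D")
    case True
    then show ?thesis using V_not_Nil[OF u] by (simp add: hd_conv_nth)
  next
    case False
    then have lt: "Suc i < D" using Suc.prems(2) by simp
    have "last v = last (take (D - Suc i) u)"
      using lt len by (simp add: pre)
    moreover have "successively R (take (D - i) u)"
      using u by (metis V_iff append_take_drop_id successively_append_iff)
    ultimately show ?thesis
      using lt u len pre by (auto simp: split[OF u] successively_append_iff)
  qed
  have "S (Suc i) v = {u. \<exists>a\<in>A. R (last v) a \<and> u \<in> V \<and> take (D - i) u = drop (Suc i) v @ [a]}"
    using Suc.prems(1) IH by (auto simp: walk_sphere_Suc[OF wf] arc_iff)
  also have "\<dots> = {u \<in> V. take (D - Suc i) u = drop (Suc i) v \<and> R (last v) (u ! (D - Suc i))}"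
  proof -
    have "u ! (D - Suc i) \<in> A" if "u \<in> V" for u
      using that Suc.prems(2) by (auto simp: V_iff in_lists_conv_set)
    then show ?thesis by (auto simp: split)
  qed
  also have "\<dots> = {u \<in> V. take (D - Suc i) u = drop (Suc i) v \<and> (Suc i = D \<longrightarrow> R (last v) (hd u))}"
    using link by auto
  finally show ?case .
qed

text \<open>
  All elements of \<open>S i x\<close> share a prefix of length \<open>D - i > 0\<close>. It contains both the prefix of length
  \<open>D - j\<close> and the first letter, and these decide membership in \<open>S j y\<close>. For \<open>i = j = D\<close> this fails
  in Kautz digraphs: two sets given by different excluded first letters overlap.
\<close>

lemma S_subset_or_disjoint:
  assumes "x \<in> V" "y \<in> V" "i < D" "i \<le> j" "j \<le> D"
  shows "S i x \<subseteq> S j y \<or> S i x \<inter> S j y = {}"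
proof -
  have agree: "take (D - j) u = take (D - j) t \<and> hd u = hd t" if "u \<in> S i x" "t \<in> S i x" for u t
  proof -
    have eq: "take (D - i) u = take (D - i) t" and "u \<in> V" "t \<in> V"
      using that assms by (auto simp: S_eq_cylinder)
    moreover have "take (D - j) (take (D - i) s) = take (D - j) s" for s :: "'a list"
      using assms by (simp add: min_def)
    moreover have "hd (take (D - i) s) = hd s" for s :: "'a list"
      using assms by (simp add: hd_take)
    ultimately show ?thesis by metis
  qed
  have "t \<in> S j y" if "u \<in> S i x" "u \<in> S j y" "t \<in> S i x" for u t
    using that agree[OF that(1,3)] assms by (simp add: S_eq_cylinder)
  then show ?thesis by blast
qed

section \<open>Avoiding smaller spheres\<close>

lemma obtain_letter:
  obtains c where "c \<in> A" "R a c" "c \<noteq> x" "c \<noteq> y"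
proof -
  have "card {x, y} \<le> 2" by (simp add: card_insert_if)
  then have "\<not> {b \<in> A. R a b} \<subseteq> {x, y}"
    using three_successors[of a] card_mono[of "{x, y}" "{b \<in> A. R a b}"] by fastforce
  then show ?thesis using that by blast
qed

text \<open>
  The greedy construction: to avoid \<open>f l\<close> and \<open>g l\<close> as prefixes of length \<open>l\<close>, it is enough that the
  \<open>l\<close>-th letter differs from the last letters of both.
\<close>

lemma avoiding_extension:
  assumes "length p \<le> n" "p \<in> lists A" "successively R p" "p \<noteq> []"
  shows "\<exists>u\<in>lists A. length u = n \<and> successively R u \<and> take (length p) u = p \<and>
           (\<forall>l. length p < l \<and> l \<le> n \<longrightarrow> take l u \<noteq> f l \<and> take l u \<noteq> g l)"
  using assms(1)
proof (induction n rule: dec_induct)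
  case base
  then show ?case using assms by (intro bexI[of _ p]) auto
next
  case (step n)
  then obtain u where u: "u \<in> lists A" "length u = n" "successively R u" "take (length p) u = p"
    and avoid: "\<And>l. length p < l \<Longrightarrow> l \<le> n \<Longrightarrow> take l u \<noteq> f l \<and> take l u \<noteq> g l"
    by blast
  obtain c where c: "c \<in> A" "R (last u) c" "c \<noteq> last (f (Suc n))" "c \<noteq> last (g (Suc n))"
    by (rule obtain_letter)
  have "take l (u @ [c]) \<noteq> f l \<and> take l (u @ [c]) \<noteq> g l" if "length p < l" "l \<le> Suc n" for l
  proof (cases "l = Suc n")
    case True
    then have "take l (u @ [c]) = u @ [c]" using u by simp
    then show ?thesis using c True by (metis last_snoc)
  next
    case False
    then show ?thesis using avoid[of l] that u by simp
  qed
  moreover have "u @ [c] \<in> lists A" "successively R (u @ [c])" "take (length p) (u @ [c]) = p"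
    using u c step.hyps by (auto simp: successively_append_iff)
  ultimately show ?case using u by (intro bexI[of _ "u @ [c]"]) auto
qed

text \<open>Lying in \<open>S k x\<close> for \<open>k < D\<close> requires the prefix \<open>drop k x\<close>, of length \<open>l = D - k\<close>.\<close>

lemma avoiding_vertex:
  assumes "x \<in> V" "y \<in> V" "p \<in> lists A" "successively R p" "p \<noteq> []" "length p \<le> D"
  obtains u where "u \<in> V" "take (length p) u = p"
    and "\<And>k. k < D - length p \<Longrightarrow> u \<notin> S k x \<and> u \<notin> S k y"
proof -
  obtain u where u: "u \<in> V" "take (length p) u = p"
    and avoid: "\<And>l. length p < l \<Longrightarrow> l \<le> D \<Longrightarrow> take l u \<noteq> drop (D - l) x \<and> take l u \<noteq> drop (D - l) y"
    using avoiding_extension[OF assms(6,3-5), of "\<lambda>l. drop (D - l) x" "\<lambda>l. drop (D - l) y"]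
    unfolding V_iff by blast
  have "u \<notin> S k x \<and> u \<notin> S k y" if "k < D - length p" for k
    using avoid[of "D - k"] that assms by (auto simp: S_eq_cylinder)
  with u show ?thesis using that by blast
qed

lemma sphere_not_covered:
  assumes "x \<in> V" "y \<in> V" "i < D"
  obtains u where "u \<in> S i x" "\<And>k. k < i \<Longrightarrow> u \<notin> S k x \<and> u \<notin> S k y"
proof -
  have "drop i x \<in> lists A" "successively R (drop i x)" "drop i x \<noteq> []" "length (drop i x) = D - i"
    using assms
    by (auto simp: V_iff in_lists_conv_set dest: in_set_dropD)
       (metis append_take_drop_id successively_append_iff)
  then obtain u where "u \<in> V" "take (D - i) u = drop i x"
    "\<And>k. k < i \<Longrightarrow> u \<notin> S k x \<and> u \<notin> S k y"
    using avoiding_vertex[OF assms(1,2), of "drop i x"] assms(3) by auto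
  then show ?thesis using that assms by (auto simp: S_eq_cylinder)
qed

lemma S_dist_iff: "u \<in> S_dist i v \<longleftrightarrow> u \<in> S i v \<and> (\<forall>k<i. u \<notin> S k v)"
  by (simp add: dist_sphere_eq[OF wf])

section \<open>Intersections of distance spheres\<close>

text \<open>
  A first letter \<open>c\<close> that is neither \<open>last x\<close> nor \<open>last y\<close> rules out the distance \<open>D - 1\<close> and is
  compatible with both; smaller distances are avoided greedily from the word \<open>[c]\<close> on.
\<close>

lemma S_dist_D_meet:
  assumes "x \<in> V" "y \<in> V"
  shows "S_dist D x \<inter> S_dist D y \<noteq> {}"
proof -
  obtain c where c: "c \<in> A" "c \<noteq> last x" "c \<noteq> last y"
    by (rule obtain_letter)
  obtain u where u: "u \<in> V" "take 1 u = [c]"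
    and avoid: "\<And>k. k < D - 1 \<Longrightarrow> u \<notin> S k x \<and> u \<notin> S k y"
    using avoiding_vertex[OF assms, of "[c]"] c D_pos by auto
  have hd: "hd u = c" using u V_not_Nil by (cases u) auto
  have "u \<in> S D z \<and> u \<notin> S (D - 1) z" if "z \<in> V" "c \<noteq> last z" for z
  proof -
    have "drop (D - 1) z = [last z]"
      using that V_not_Nil[of z] D_pos by (cases z rule: rev_cases) (auto simp: V_iff)
    moreover have "R (last z) c" using that neq_imp_R by metis
    ultimately show ?thesis
      using that u hd D_pos by (auto simp: S_eq_cylinder V_iff)
  qed
  moreover have "k < D \<Longrightarrow> k < D - 1 \<or> k = D - 1" for k by linarith
  ultimately have "u \<in> S_dist D x" "u \<in> S_dist D y"
    using avoid assms c by (metis S_dist_iff)+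
  then show ?thesis by blast
qed

text \<open>
  By laminarity a sphere \<open>S k w\<close> with \<open>i \<le> k < j\<close> removes all of \<open>S i v\<close> or nothing, and the
  spheres with index below \<open>i\<close> leave a vertex over.
\<close>

lemma S_dist_meet_iff_least:
  assumes "v \<in> V" "w \<in> V" "i < D" "i \<le> j" "j \<le> D"
  shows "S_dist i v \<inter> S_dist j w \<noteq> {} \<longleftrightarrow>
           S i v \<subseteq> S j w \<and> (\<forall>k. i \<le> k \<and> k < j \<longrightarrow> \<not> S i v \<subseteq> S k w)"
proof
  assume "S_dist i v \<inter> S_dist j w \<noteq> {}"
  then obtain u where "u \<in> S i v" "u \<in> S j w" "\<forall>k<j. u \<notin> S k w"
    by (auto simp: S_dist_iff)
  then show "S i v \<subseteq> S j w \<and> (\<forall>k. i \<le> k \<and> k < j \<longrightarrow> \<not> S i v \<subseteq> S k w)"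
    using S_subset_or_disjoint[OF assms] by blast
next
  assume least: "S i v \<subseteq> S j w \<and> (\<forall>k. i \<le> k \<and> k < j \<longrightarrow> \<not> S i v \<subseteq> S k w)"
  obtain u where u: "u \<in> S i v" "\<And>k. k < i \<Longrightarrow> u \<notin> S k v \<and> u \<notin> S k w"
    using sphere_not_covered[OF assms(1-3)] by blast
  have "u \<notin> S k w" if "k < j" for k
  proof (cases "k < i")
    case False
    then have "S i v \<inter> S k w = {}"
      using least that S_subset_or_disjoint[OF assms(1-3), of k] assms(5) by auto
    then show ?thesis using u by blast
  qed (use u in blast)
  then have "u \<in> S_dist i v" "u \<in> S_dist j w"
    using u least by (auto simp: S_dist_iff)
  then show "S_dist i v \<inter> S_dist j w \<noteq> {}" by blast
qed

text \<open>
  \<open>walk_sphere_in G k j w\<close> is nonempty only for those \<open>S k w\<close> inside \<open>S j w\<close> that are contained in no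
  intermediate sphere. Testing these suffices: if some \<open>S k w\<close> contains \<open>S i v\<close>, then the one with
  the largest \<open>k < j\<close> is of this kind.
\<close>

lemma S_dist_meet_iff_walk_sphere_in:
  assumes "v \<in> V" "w \<in> V" "i < D" "i \<le> j" "j \<le> D"
  shows "S_dist i v \<inter> S_dist j w \<noteq> {} \<longleftrightarrow>
           S i v \<inter> S j w \<noteq> {} \<and>
           (\<forall>k. i \<le> k \<and> k < j \<longrightarrow> \<not> S i v \<subseteq> walk_sphere_in G k j w)"
proof -
  have ne: "S i v \<noteq> {}"
    using sphere_not_covered[OF assms(1-3)] by blast
  have inside: "S i v \<inter> S j w \<noteq> {} \<longleftrightarrow> S i v \<subseteq> S j w"
    using S_subset_or_disjoint[OF assms] ne by blast
  have "(\<exists>k. i \<le> k \<and> k < j \<and> S i v \<subseteq> S k w) \<longleftrightarrow>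
        (\<exists>k. i \<le> k \<and> k < j \<and> S i v \<subseteq> walk_sphere_in G k j w)" (is "?plain \<longleftrightarrow> ?max")
    if sub: "S i v \<subseteq> S j w"
  proof
    assume ?plain
    define K where "K = {k. i \<le> k \<and> k < j \<and> S i v \<subseteq> S k w}"
    define k where "k = Max K"
    have "finite K" "K \<noteq> {}" using \<open>?plain\<close> by (auto simp: K_def)
    then have k: "i \<le> k" "k < j" "S i v \<subseteq> S k w" and k_max: "\<And>l. l \<in> K \<Longrightarrow> l \<le> k"
      using Max_in[of K] by (auto simp: k_def K_def)
    have "S k w \<subseteq> S j w"
      using S_subset_or_disjoint[OF assms(2,2), of k j] k sub ne assms by auto
    moreover have "\<not> S k w \<subseteq> S l w" if "k < l" "l < j" for l
      using k_max[of l] that k by (auto simp: K_def)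
    ultimately have "walk_sphere_in G k j w = S k w"
      by (simp add: walk_sphere_in_def)
    then show ?max using k by metis
  next
    assume ?max
    then show ?plain using ne by (auto simp: walk_sphere_in_def split: if_splits)
  qed
  then show ?thesis
    unfolding S_dist_meet_iff_least[OF assms] inside by blast
qed

text \<open>
  For \<open>i < D\<close> the index is the least one with \<open>S i v \<subseteq> S j w\<close>. One exists because a word
  \<open>u\<close> that starts with the last letter of \<open>w\<close> is in \<open>S (D - 1) w\<close>, and any other word is
  in \<open>S D w\<close>.
\<close>

lemma ex1_S_dist_meet:
  assumes "v \<in> V" "w \<in> V" "i \<le> D"
  shows "\<exists>!j. i \<le> j \<and> j \<le> D \<and> S_dist i v \<inter> S_dist j w \<noteq> {}"
proof (cases "i = D")
  case True
  then show ?thesis using S_dist_D_meet[OF assms(1,2)] by (auto intro!: ex1I[of _ D])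
next
  case False
  then have i: "i < D" using assms by simp
  define J where "J = {j. i \<le> j \<and> j \<le> D \<and> S i v \<subseteq> S j w}"
  obtain u where u: "u \<in> S i v" using sphere_not_covered[OF assms(1,2) i] by blast
  have "u \<in> S (D - 1) w \<or> u \<in> S D w"
  proof -
    have "drop (D - 1) w = [last w]"
      using assms V_not_Nil[of w] D_pos by (cases w rule: rev_cases) (auto simp: V_iff)
    moreover have "u \<in> V" using u assms by (simp add: S_eq_cylinder)
    moreover from this have "take 1 u = [hd u]" using V_not_Nil by (cases u) auto
    ultimately show ?thesis
      using neq_imp_R[of "last w" "hd u"] D_pos assms(2)
      by (cases "last w = hd u") (auto simp: S_eq_cylinder V_iff)
  qed
  then obtain j where j: "u \<in> S j w" "i \<le> j" "j \<le> D"
  proof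
    assume "u \<in> S (D - 1) w"
    then show ?thesis using that[of "D - 1"] i by linarith
  next
    assume "u \<in> S D w"
    then show ?thesis using that[of D] i by linarith
  qed
  then have "j \<in> J"
    using S_subset_or_disjoint[OF assms(1,2) i] u by (auto simp: J_def)
  then have "\<exists>j. j \<in> J" by blast
  then have least: "(LEAST j. j \<in> J) \<in> J" "\<And>j. j \<in> J \<Longrightarrow> (LEAST j. j \<in> J) \<le> j"
    by (auto intro: LeastI_ex Least_le)
  have "i \<le> j \<and> j \<le> D \<and> S_dist i v \<inter> S_dist j w \<noteq> {} \<longleftrightarrow> j \<in> J \<and> (\<forall>k\<in>J. j \<le> k)" for j
  proof -
    have "(\<forall>k. i \<le> k \<and> k < j \<longrightarrow> \<not> S i v \<subseteq> S k w) \<longleftrightarrow> (\<forall>k\<in>J. j \<le> k)" if "j \<le> D"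
    proof (intro iffI ballI)
      fix k
      assume "\<forall>k. i \<le> k \<and> k < j \<longrightarrow> \<not> S i v \<subseteq> S k w" "k \<in> J"
      then show "j \<le> k" unfolding J_def by (auto intro: leI)
    next
      assume min: "\<forall>k\<in>J. j \<le> k"
      have "k \<in> J" if "i \<le> k" "k < j" "S i v \<subseteq> S k w" for k
        using that \<open>j \<le> D\<close> by (simp add: J_def)
      then show "\<forall>k. i \<le> k \<and> k < j \<longrightarrow> \<not> S i v \<subseteq> S k w"
        using min by (meson leD)
    qed
    then show ?thesis
      using S_dist_meet_iff_least[OF assms(1,2) i, of j] unfolding J_def by blast
  qed
  then show ?thesis
    using least by (auto intro!: ex1I[of _ "LEAST j. j \<in> J"] antisym)
qed

text \<open>
  A walk from \<open>w\<close> of length \<open>i - 1\<close> extends to a walk from \<open>v\<close> of length \<open>i\<close>. Take a vertex \<open>u\<close> of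
  \<open>S (i - 1) w\<close> that avoids all smaller spheres of \<open>v\<close> and \<open>w\<close>. It fails to have distance \<open>i\<close>
  from \<open>v\<close> only if it is in \<open>S (i - 1) v\<close>, so that the cylinders of \<open>v\<close> and \<open>w\<close> coincide.
\<close>

lemma S_dist_pred_disjoint_iff:
  assumes "v \<in> V" "(v, w) \<in> parcs G" "1 \<le> i" "i \<le> D"
  shows "S_dist i v \<inter> S_dist (i - 1) w = {} \<longleftrightarrow> drop (i - 1) v = drop (i - 1) w"
proof
  have w: "w \<in> V" using assms successor_in_V by (auto simp: arc_iff)
  have i: "i - 1 < D" using assms by simp
  { assume "S_dist i v \<inter> S_dist (i - 1) w = {}"
    obtain u where u: "u \<in> S (i - 1) w" "\<And>k. k < i - 1 \<Longrightarrow> u \<notin> S k w \<and> u \<notin> S k v"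
      using sphere_not_covered[OF w assms(1) i] by blast
    then have "u \<in> S_dist (i - 1) w" by (simp add: S_dist_iff)
    have "u \<in> S i v"
      using walk_sphere_Suc[OF wf, of "i - 1" v] u assms by auto
    moreover have "u \<notin> S_dist i v"
      using \<open>u \<in> S_dist (i - 1) w\<close> \<open>S_dist i v \<inter> S_dist (i - 1) w = {}\<close> by blast
    ultimately obtain k where "k < i" "u \<in> S k v" by (auto simp: S_dist_iff)
    then have "u \<in> S (i - 1) v" using u(2)[of k] by (cases "k = i - 1") auto
    then show "drop (i - 1) v = drop (i - 1) w"
      using u(1) assms w i by (auto simp: S_eq_cylinder) }
  { assume "drop (i - 1) v = drop (i - 1) w"
    then have "S (i - 1) v = S (i - 1) w"
      using assms w i by (auto simp: S_eq_cylinder)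
    moreover have "u \<notin> S (i - 1) v" if "u \<in> S_dist i v" for u
      using that assms(3) by (simp add: S_dist_iff)
    moreover have "u \<in> S (i - 1) w" if "u \<in> S_dist (i - 1) w" for u
      using that by (simp add: S_dist_iff)
    ultimately show "S_dist i v \<inter> S_dist (i - 1) w = {}" by blast }
qed

text \<open>
  Since \<open>w\<close> is \<open>v\<close> shifted by one, agreement at a position means that the letter of \<open>v\<close> there equals
  the next one, or at the last position the letter that the arc appends.
\<close>

lemma drop_eq_successor_iff:
  assumes "v \<in> V" "(v, w) \<in> parcs G" "1 \<le> i" "i \<le> D"
  shows "drop (i - 1) v = drop (i - 1) w \<longleftrightarrow> (\<forall>k. i \<le> k \<and> k \<le> D \<longrightarrow> v ! (k - 1) = w ! (D - 1))"
proof -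
  have len: "length v = D" "length w = D"
    using assms successor_in_V by (auto simp: arc_iff V_iff)
  have shift: "w ! m = v ! Suc m" if "Suc m < D" for m
    using assms(2) that len by (auto simp: arc_iff nth_append nth_tl)
  have "drop (i - 1) v = drop (i - 1) w \<longleftrightarrow> (\<forall>m. i - 1 \<le> m \<and> m < D \<longrightarrow> v ! m = w ! m)"
    (is "_ \<longleftrightarrow> ?pointwise")
  proof -
    have "drop (i - 1) v = drop (i - 1) w \<longleftrightarrow> (\<forall>m<D - (i - 1). v ! (i - 1 + m) = w ! (i - 1 + m))"
      using len assms(4) by (simp add: list_eq_iff_nth_eq)
    also have "\<dots> \<longleftrightarrow> ?pointwise"
    proof (intro iffI allI impI)
      fix m
      assume "\<forall>m<D - (i - 1). v ! (i - 1 + m) = w ! (i - 1 + m)" "i - 1 \<le> m \<and> m < D"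
      then show "v ! m = w ! m" by (auto dest: spec[of _ "m - (i - 1)"])
    qed auto
    finally show ?thesis .
  qed
  also have "\<dots> \<longleftrightarrow> (\<forall>m. i - 1 \<le> m \<and> m < D \<longrightarrow> v ! m = w ! (D - 1))"
  proof (intro iffI allI impI)
    fix m
    assume eq: ?pointwise and "i - 1 \<le> m \<and> m < D"
    then have "m \<le> D - 1" "i - 1 \<le> m" by auto
    then show "v ! m = w ! (D - 1)"
    proof (induction m rule: inc_induct)
      case base
      then show ?case using eq D_pos by auto
    next
      case (step m)
      then show ?case using eq shift[of m] by auto
    qed
  next
    fix m
    assume const: "\<forall>m. i - 1 \<le> m \<and> m < D \<longrightarrow> v ! m = w ! (D - 1)"
      and m: "i - 1 \<le> m \<and> m < D"
    show "v ! m = w ! m"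
    proof (cases "Suc m < D")
      case True
      then show ?thesis using const m shift[of m] by auto
    next
      case False
      then have "m = D - 1" using m by linarith
      then show ?thesis using const m by simp
    qed
  qed
  also have "\<dots> \<longleftrightarrow> (\<forall>k. i \<le> k \<and> k \<le> D \<longrightarrow> v ! (k - 1) = w ! (D - 1))"
  proof (intro iffI allI impI)
    fix k
    assume "\<forall>m. i - 1 \<le> m \<and> m < D \<longrightarrow> v ! m = w ! (D - 1)" "i \<le> k \<and> k \<le> D"
    moreover from this have "i - 1 \<le> k - 1" "k - 1 < D" using assms(3) by linarith+
    ultimately show "v ! (k - 1) = w ! (D - 1)" by blast
  next
    fix m
    assume "\<forall>k. i \<le> k \<and> k \<le> D \<longrightarrow> v ! (k - 1) = w ! (D - 1)" "i - 1 \<le> m \<and> m < D"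
    then show "v ! m = w ! (D - 1)" by (auto dest: spec[of _ "Suc m"])
  qed
  finally show ?thesis .
qed

text \<open>
  The hypothesis makes \<open>S i v\<close> and \<open>S i w\<close> equal when \<open>i < D\<close>, so \<open>j = i\<close> is the least admissible index.
\<close>

lemma S_dist_meet_if_drop_eq:
  assumes "v \<in> V" "(v, w) \<in> parcs G" "1 \<le> i" "i \<le> D" "drop (i - 1) v = drop (i - 1) w"
  shows "S_dist i v \<inter> S_dist i w \<noteq> {}"
proof (cases "i = D")
  case True
  then show ?thesis
    using S_dist_D_meet assms successor_in_V by (auto simp: arc_iff)
next
  case False
  have w: "w \<in> V" using assms successor_in_V by (auto simp: arc_iff)
  have "drop i v = drop i w"
    using assms(3,5) by (metis Suc_diff_1 drop_Suc less_le_trans less_numeral_extra(1) tl_drop)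
  then have "S i v = S i w"
    using False assms w by (simp add: S_eq_cylinder)
  then show ?thesis
    using S_dist_meet_iff_least[of v w i i] False assms w by auto
qed

end

section \<open>De Bruijn and Kautz digraphs\<close>

lemma word_shift_de_bruijn:
  assumes "card A \<ge> 3" "D \<ge> 1"
  shows "word_shift A (\<lambda>_ _. True) D"
  using assms by unfold_locales auto

lemma word_shift_kautz:
  assumes "card A \<ge> 4" "D \<ge> 1"
  shows "word_shift A (\<noteq>) D"
proof
  fix a
  have "{b \<in> A. a \<noteq> b} = A - {a}" by auto
  then show "card {b \<in> A. a \<noteq> b} \<ge> 3"
    using assms diff_card_le_card_Diff[of "{a}" A] by simp
qed (use assms in auto)

theorem proposition3:
  fixes A :: "'a set" and d D i :: nat and G :: "'a list pair_pre_digraph"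
    and v w :: "'a list"
  assumes "d \<ge> 3" and "D \<ge> 1"
    and "(card A = d \<and> G = de_bruijn A D) \<or> (card A = d + 1 \<and> G = kautz A D)"
    and "v \<in> pverts G" and "w \<in> walk_sphere G 1 v"
    and "1 \<le> i" and "i \<le> D"
  shows
    "(\<forall>j. i = j \<and> j = D \<longrightarrow> dist_sphere G i v \<inter> dist_sphere G j w \<noteq> {}) \<and>
     (\<forall>j. D \<ge> j \<and> j \<ge> i \<and> i \<noteq> D \<longrightarrow>
        (dist_sphere G i v \<inter> dist_sphere G j w \<noteq> {} \<longleftrightarrow>
           walk_sphere G i v \<inter> walk_sphere G j w \<noteq> {} \<and>
           (\<forall>k. i \<le> k \<and> k < j \<longrightarrow> \<not> walk_sphere G i v \<subseteq> walk_sphere_in G k j w))) \<and>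
     ((dist_sphere G i v \<inter> dist_sphere G (i - 1) w = {} \<longleftrightarrow>
         (card A = d \<and> G = de_bruijn A D) \<and>
         (\<forall>k. i \<le> k \<and> k \<le> D \<longrightarrow> v ! (k - 1) = w ! (D - 1))) \<and>
      (dist_sphere G i v \<inter> dist_sphere G (i - 1) w = {} \<longrightarrow>
         dist_sphere G i v \<inter> dist_sphere G i w \<noteq> {})) \<and>
     (\<exists>!j. i \<le> j \<and> j \<le> D \<and> dist_sphere G i v \<inter> dist_sphere G j w \<noteq> {})"
proof -
  define R :: "'a \<Rightarrow> 'a \<Rightarrow> bool" where
    "R = (if card A = d then (\<lambda>_ _. True) else (\<noteq>))"
  have G_eq: "G = word_digraph A R D"
    using assms(3) by (auto simp: R_def de_bruijn_eq_word_digraph kautz_eq_word_digraph)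
  have "word_shift A R D"
    using assms(1-3) by (auto simp: R_def intro: word_shift_de_bruijn word_shift_kautz)
  then interpret word_shift A R D .
  note [simp] = G_eq
  have v: "v \<in> pverts (word_digraph A R D)" using assms(4) by simp
  have arc: "(v, w) \<in> parcs (word_digraph A R D)"
    using assms(5) walk_sphere_Suc[OF wf, of 0 v] walk_sphere_0[OF wf]
    by (auto simp: arc_iff successor_in_V)
  then have w: "w \<in> pverts (word_digraph A R D)"
    by (auto simp: arc_iff successor_in_V)
  \<comment> \<open>In a Kautz digraph the last letters of adjacent vertices differ, which contradicts the case \<open>k = D\<close>.\<close>
  have db: "card A = d \<and> G = de_bruijn A D"
    if const: "\<forall>k. i \<le> k \<and> k \<le> D \<longrightarrow> v ! (k - 1) = w ! (D - 1)"
  proof (rule ccontr)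
    assume "\<not> ?thesis"
    then have "R = (\<noteq>)" using assms(3) by (auto simp: R_def)
    then have "last v \<noteq> last w" using arc unfolding arc_iff by auto
    moreover have "last v = v ! (D - 1)" "last w = w ! (D - 1)"
      using v w V_not_Nil by (auto simp: V_iff last_conv_nth)
    ultimately show False using const assms(7) by auto
  qed
  have "dist_sphere G i v \<inter> dist_sphere G (i - 1) w = {} \<longleftrightarrow>
      (\<forall>k. i \<le> k \<and> k \<le> D \<longrightarrow> v ! (k - 1) = w ! (D - 1))"
    using S_dist_pred_disjoint_iff[OF v arc assms(6,7)] drop_eq_successor_iff[OF v arc assms(6,7)]
    by simp
  moreover have "dist_sphere G i v \<inter> dist_sphere G i w \<noteq> {}"
    if "dist_sphere G i v \<inter> dist_sphere G (i - 1) w = {}"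
    using that S_dist_pred_disjoint_iff[OF v arc assms(6,7)]
      S_dist_meet_if_drop_eq[OF v arc assms(6,7)] by simp
  ultimately show ?thesis
    using db S_dist_D_meet[OF v w] ex1_S_dist_meet[OF v w assms(7)]
      S_dist_meet_iff_walk_sphere_in[OF v w, of i] assms(7)
    unfolding G_eq by (intro conjI allI impI) (simp_all | blast)+
qed

end
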